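(* Let $f$ be a probability density on $\mathbb{R}$ with $f(x)\propto\exp(g(x))$ for $x>0$ and $f(x)=0$ otherwise, where $g$ is twice differentiable on $[0,\infty)$ with $\sup_{x\ge0}|g'(x)|<\infty$. Let $\pi_d(\mathbf{x}^d)=\prod_{i=1}^d f(x_i)$, $f^\star=\lim_{x\downarrow0}f(x)$, and for $l>0$ let $\sigma_d=l/d$, $a(l)=\exp(-f^\star l/4)$ and $\phi(l)=\frac{l^2}{3}\exp(-f^\star l/4)$. With $\mathbf{X}_0^d\sim\pi_d$, $$\mathbb{E}_{\pi_d}\left[J_d(\mathbf{X}_0^d)\right]\to a(l)\qquad\text{as } d\to\infty.$$ Moreover, $\phi(l)$ (as a function of $l>0$) is maximized by $l=\hat l=8/f^\star$, and $$a(\hat l)=\exp(-2)\ (=0.1353\text{ to four decimal places}).$$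
   Context: $J_d(\mathbf{x}^d)$ is the probability that the random walk Metropolis algorithm with target $\pi_d$ accepts a proposed move from $\mathbf{x}^d$: $$J_d(\mathbf{x}^d)=\mathbb{E}\left[1\wedge\frac{\pi_d(\mathbf{x}^d+\sigma_d\mathbf{Z}^d)}{\pi_d(\mathbf{x}^d)}\right],$$ where $\mathbf{Z}^d$ has i.i.d. components uniform on $[-1,1]$. *)

theory Defs
  imports "HOL-Probability.Probability"
begin

definition prob_density :: "(real \<Rightarrow> real) \<Rightarrow> bool" where
  "prob_density f \<longleftrightarrow>
     f \<in> borel_measurable borel \<and> (\<forall>x. 0 \<le> f x) \<and> (\<integral>\<^sup>+x. ennreal (f x) \<partial>lborel) = 1"

(* A point of R^d is a function nat => real, of which only the coordinates
   0, ..., d - 1 matter; the corresponding product measures live on PiM {..<d}. *)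

definition target :: "(real \<Rightarrow> real) \<Rightarrow> nat \<Rightarrow> (nat \<Rightarrow> real) \<Rightarrow> real" where
  "target f d x = (\<Prod>i<d. f (x i))"

definition target_law :: "(real \<Rightarrow> real) \<Rightarrow> nat \<Rightarrow> (nat \<Rightarrow> real) measure" where
  "target_law f d = density (Pi\<^sub>M {..<d} (\<lambda>_. lborel)) (\<lambda>x. ennreal (target f d x))"

definition proposal_law :: "nat \<Rightarrow> (nat \<Rightarrow> real) measure" where
  "proposal_law d = Pi\<^sub>M {..<d} (\<lambda>_. uniform_measure lborel {-1..1})"

(* Where the target density vanishes at x, division by zero makes this 0; such x form a
   null set under target_law. *)
definition accept_prob :: "(real \<Rightarrow> real) \<Rightarrow> real \<Rightarrow> nat \<Rightarrow> (nat \<Rightarrow> real) \<Rightarrow> real" where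
  "accept_prob f \<sigma> d x =
     (\<integral>z. min 1 (target f d (\<lambda>i. x i + \<sigma> * z i) / target f d x) \<partial>proposal_law d)"

definition fstar :: "(real \<Rightarrow> real) \<Rightarrow> real" where
  "fstar f = Lim (at_right 0) f"

definition acc_limit :: "(real \<Rightarrow> real) \<Rightarrow> real \<Rightarrow> real" where
  "acc_limit f l = exp (- fstar f * l / 4)"

definition speed :: "(real \<Rightarrow> real) \<Rightarrow> real \<Rightarrow> real" where
  "speed f l = l\<^sup>2 / 3 * exp (- fstar f * l / 4)"

end

theory Submission
  imports Defs
begin

text \<open>Let \<open>X\<close> follow the target and let \<open>\<sigma> = l / d\<close>. With \<open>A\<close> the event that all coordinates
  of \<open>X + \<sigma> Z\<close> stay positive and \<open>S\<close> the sum of the increments of \<open>g\<close>, the acceptance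
  probability is the expectation of \<open>min 1 (exp S)\<close> on \<open>A\<close>, so it differs from the probability of
  \<open>A\<close> by at most \<open>E \<bar>S\<bar> \<le> sqrt (E S\<^sup>2)\<close>. This tends to \<open>0\<close>: each increment is \<open>O(1 / d)\<close> since \<open>g'\<close> is
  bounded, and has mean \<open>o(1 / d)\<close> by dominated convergence since \<open>Z\<^sub>i\<close> is centred and independent
  of \<open>X\<^sub>i\<close>. One coordinate leaves the half-line with probability
  \<open>\<sigma> \<integral>\<^sub>0\<^sup>1 f(\<sigma> y) (1 - y) / 2 dy \<sim> f\<^sup>\<star> l / (4 d)\<close>, so the probability of \<open>A\<close> tends to
  \<open>exp (- f\<^sup>\<star> l / 4)\<close>.\<close>

section \<open>Product measures with product densities\<close>

text \<open>A product measure is determined by its values on boxes, and on a box the integrand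
  splits into one factor per coordinate. With it, \<open>target_law\<close> becomes the law of
  i.i.d. coordinates.\<close>

lemma (in product_sigma_finite) density_PiM:
  assumes [simp]: "finite I"
    and meas [measurable]: "\<And>i. h i \<in> borel_measurable (M i)"
    and "\<And>i. sigma_finite_measure (density (M i) (h i))"
  shows "density (Pi\<^sub>M I M) (\<lambda>x. \<Prod>i\<in>I. h i (x i)) = Pi\<^sub>M I (\<lambda>i. density (M i) (h i))"
proof -
  interpret D: product_sigma_finite "\<lambda>i. density (M i) (h i)"
    unfolding product_sigma_finite_def using assms(3) by blast
  show ?thesis
  proof (rule D.PiM_eqI)
    show "sets (density (Pi\<^sub>M I M) (\<lambda>x. \<Prod>i\<in>I. h i (x i)))
        = sets (Pi\<^sub>M I (\<lambda>i. density (M i) (h i)))"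
      by (simp cong: sets_PiM_cong)
  next
    fix A assume "\<And>i. i \<in> I \<Longrightarrow> A i \<in> sets (density (M i) (h i))"
    then have A: "\<And>i. i \<in> I \<Longrightarrow> A i \<in> sets (M i)" by simp
    \<comment> \<open>Since \<open>x\<close> is extensional, being a point of the space, it can miss
      the box only through a coordinate in \<open>I\<close>, where the indicator factor
      vanishes.\<close>
    have ind: "indicator (Pi\<^sub>E I A) x = (\<Prod>i\<in>I. indicator (A i) (x i) :: ennreal)"
      if x: "x \<in> space (Pi\<^sub>M I M)" for x
    proof (cases "x \<in> Pi\<^sub>E I A")
      case True
      then show ?thesis by (auto simp: indicator_def PiE_iff)
    next
      case False
      then obtain i where "i \<in> I" "x i \<notin> A i"
        using x by (auto simp: space_PiM PiE_iff)
      then have "(\<Prod>i\<in>I. indicator (A i) (x i) :: ennreal) = 0"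
        by (intro prod_zero) (auto intro!: bexI[of _ i])
      with False show ?thesis by simp
    qed
    have "emeasure (density (Pi\<^sub>M I M) (\<lambda>x. \<Prod>i\<in>I. h i (x i))) (Pi\<^sub>E I A)
        = (\<integral>\<^sup>+x. (\<Prod>i\<in>I. h i (x i)) * indicator (Pi\<^sub>E I A) x \<partial>Pi\<^sub>M I M)"
      using A by (intro emeasure_density) (auto intro!: sets_PiM_I_finite)
    also have "\<dots> = (\<integral>\<^sup>+x. (\<Prod>i\<in>I. h i (x i) * indicator (A i) (x i)) \<partial>Pi\<^sub>M I M)"
      by (intro nn_integral_cong) (simp add: ind prod.distrib)
    also have "\<dots> = (\<Prod>i\<in>I. \<integral>\<^sup>+x. h i x * indicator (A i) x \<partial>M i)"
      using A by (intro product_nn_integral_prod) auto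
    also have "\<dots> = (\<Prod>i\<in>I. emeasure (density (M i) (h i)) (A i))"
      using A by (intro prod.cong) (auto simp: emeasure_density)
    finally show "emeasure (density (Pi\<^sub>M I M) (\<lambda>x. \<Prod>i\<in>I. h i (x i))) (Pi\<^sub>E I A)
        = (\<Prod>i\<in>I. emeasure (density (M i) (h i)) (A i))" .
  qed simp
qed

section \<open>Expectations under i.i.d. pairs of coordinates\<close>

context pair_prob_space
begin

text \<open>A pair of vectors, not a vector of pairs: this is the shape of the iterated integral
  over the current state and the proposal noise. The pairs \<open>(fst p i, snd p i)\<close> are
  i.i.d. with law \<open>M1 \<Otimes>\<^sub>M M2\<close>.\<close>

abbreviation pairs :: "'i set \<Rightarrow> (('i \<Rightarrow> 'a) \<times> ('i \<Rightarrow> 'b)) measure" where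
  "pairs I \<equiv> Pi\<^sub>M I (\<lambda>_. M1) \<Otimes>\<^sub>M Pi\<^sub>M I (\<lambda>_. M2)"

lemma prob_space_PiM1: "prob_space (Pi\<^sub>M I (\<lambda>_. M1))"
  and prob_space_PiM2: "prob_space (Pi\<^sub>M I (\<lambda>_. M2))"
  by (auto intro: prob_space_PiM M1.prob_space_axioms M2.prob_space_axioms)

lemma pair_prob_space_pairs: "pair_prob_space (Pi\<^sub>M I (\<lambda>_. M1)) (Pi\<^sub>M I (\<lambda>_. M2))"
  by (simp add: pair_prob_space_def pair_sigma_finite_def prob_space_PiM1 prob_space_PiM2
      prob_space_imp_sigma_finite)

lemma prob_space_pairs: "prob_space (pairs I)"
proof -
  interpret Q: pair_prob_space "Pi\<^sub>M I (\<lambda>_. M1)" "Pi\<^sub>M I (\<lambda>_. M2)"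
    by (rule pair_prob_space_pairs)
  show ?thesis by (rule Q.P.prob_space_axioms)
qed

text \<open>Fubini separates the two vectors, the product rule applies first to the inner and then
  to the outer integral, and Fubini in each coordinate recombines them. Boundedness supplies
  integrability throughout.\<close>

lemma expectation_pairs_prod:
  fixes u :: "'i \<Rightarrow> 'a \<times> 'b \<Rightarrow> real"
  assumes fin: "finite I"
    and meas [measurable]: "\<And>i. u i \<in> borel_measurable (M1 \<Otimes>\<^sub>M M2)"
    and bnd: "\<And>i p. \<bar>u i p\<bar> \<le> B i"
  shows "(\<integral>p. (\<Prod>i\<in>I. u i (fst p i, snd p i)) \<partial>pairs I) = (\<Prod>i\<in>I. \<integral>p. u i p \<partial>(M1 \<Otimes>\<^sub>M M2))"
proof -
  interpret Q: pair_prob_space "Pi\<^sub>M I (\<lambda>_. M1)" "Pi\<^sub>M I (\<lambda>_. M2)"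
    by (rule pair_prob_space_pairs)
  interpret A: product_sigma_finite "\<lambda>_::'i. M1" by standard
  interpret B: product_sigma_finite "\<lambda>_::'i. M2" by standard
  have int: "integrable (M1 \<Otimes>\<^sub>M M2) (u i)" for i
    by (rule P.integrable_const_bound[where B = "B i"]) (auto simp: bnd)
  have int2: "integrable M2 (\<lambda>z. u i (x, z))" if "x \<in> space M1" for i x
    using that by (intro M2.integrable_const_bound[where B = "B i"]) (auto simp: bnd)
  have intP: "integrable (pairs I) (\<lambda>p. \<Prod>i\<in>I. u i (fst p i, snd p i))"
  proof (rule Q.P.integrable_const_bound[where B = "\<Prod>i\<in>I. B i"])
    show "AE p in pairs I. norm (\<Prod>i\<in>I. u i (fst p i, snd p i)) \<le> (\<Prod>i\<in>I. B i)"
      by (auto simp: abs_prod bnd intro!: prod_mono)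
    show "(\<lambda>p. \<Prod>i\<in>I. u i (fst p i, snd p i)) \<in> borel_measurable (pairs I)"
      using fin by measurable
  qed
  have "(\<integral>p. (\<Prod>i\<in>I. u i (fst p i, snd p i)) \<partial>pairs I)
      = (\<integral>x. \<integral>z. (\<Prod>i\<in>I. u i (x i, z i)) \<partial>Pi\<^sub>M I (\<lambda>_. M2) \<partial>Pi\<^sub>M I (\<lambda>_. M1))"
    using Q.integral_fst'[OF intP] by simp
  also have "\<dots> = (\<integral>x. (\<Prod>i\<in>I. \<integral>z. u i (x i, z) \<partial>M2) \<partial>Pi\<^sub>M I (\<lambda>_. M1))"
  proof (intro Bochner_Integration.integral_cong refl)
    fix x assume "x \<in> space (Pi\<^sub>M I (\<lambda>_. M1))"
    then have "x i \<in> space M1" if "i \<in> I" for i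
      using that by (auto simp: space_PiM)
    then show "(\<integral>z. (\<Prod>i\<in>I. u i (x i, z i)) \<partial>Pi\<^sub>M I (\<lambda>_. M2)) = (\<Prod>i\<in>I. \<integral>z. u i (x i, z) \<partial>M2)"
      by (intro B.product_integral_prod[OF fin] int2) auto
  qed
  also have "\<dots> = (\<Prod>i\<in>I. \<integral>x. \<integral>z. u i (x, z) \<partial>M2 \<partial>M1)"
    by (intro A.product_integral_prod[OF fin] integrable_fst' int)
  also have "\<dots> = (\<Prod>i\<in>I. \<integral>p. u i p \<partial>(M1 \<Otimes>\<^sub>M M2))"
    by (intro prod.cong refl integral_fst' int)
  finally show ?thesis .
qed

text \<open>Expanding the square leaves diagonal terms of at most \<open>B\<^sup>2\<close> and
  off-diagonal terms that factor, by independence, into the square of the mean. Adding that square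
  to the diagonal bound as well keeps the double sum in closed form.\<close>

lemma expectation_pairs_sum_square:
  fixes u :: "'a \<times> 'b \<Rightarrow> real"
  assumes fin: "finite I"
    and meas [measurable]: "u \<in> borel_measurable (M1 \<Otimes>\<^sub>M M2)"
    and bnd: "\<And>p. \<bar>u p\<bar> \<le> B"
  shows "(\<integral>p. (\<Sum>i\<in>I. u (fst p i, snd p i))\<^sup>2 \<partial>pairs I)
    \<le> real (card I) * B\<^sup>2 + (real (card I) * (\<integral>p. u p \<partial>(M1 \<Otimes>\<^sub>M M2)))\<^sup>2"
proof -
  interpret Q: prob_space "pairs I" by (rule prob_space_pairs)
  let ?m = "\<integral>p. u p \<partial>(M1 \<Otimes>\<^sub>M M2)"
  have B: "0 \<le> B" using bnd[of undefined] by linarith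
  have intP: "integrable (pairs I) (\<lambda>p. u (fst p i, snd p i) * u (fst p j, snd p j))"
    if "i \<in> I" "j \<in> I" for i j
    using that by (intro Q.integrable_const_bound[where B = "B * B"])
      (auto simp: abs_mult B intro!: mult_mono bnd)
  have cov: "(\<integral>p. u (fst p i, snd p i) * u (fst p j, snd p j) \<partial>pairs I)
      \<le> (if i = j then B\<^sup>2 else 0) + ?m\<^sup>2" if ij: "i \<in> I" "j \<in> I" for i j
  proof (cases "i = j")
    case True
    have "(\<integral>p. u (fst p i, snd p i) * u (fst p j, snd p j) \<partial>pairs I) \<le> (\<integral>p. B\<^sup>2 \<partial>pairs I)"
    proof (rule integral_mono[OF intP[OF ij]])
      show "u (fst p i, snd p i) * u (fst p j, snd p j) \<le> B\<^sup>2" for p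
        using True B bnd[of "(fst p i, snd p i)"] 
        by (simp add: power2_eq_square[symmetric] abs_le_square_iff[symmetric])
    qed simp
    also have "\<dots> = B\<^sup>2" by (simp add: Q.prob_space)
    finally show ?thesis using True by (simp add: add_increasing2)
  next
    case False
    \<comment> \<open>Padding with the factor 1 at all other indices turns a product of two
      coordinates into a product over \<open>I\<close>, to which
      \<open>expectation_pairs_prod\<close> applies.\<close>
    let ?v = "\<lambda>k p. if k = i \<or> k = j then u p else 1"
    have pr: "(\<Prod>k\<in>I. if k = i \<or> k = j then w k else 1) = w i * w j" for w :: "'c \<Rightarrow> real"
    proof -
      have "(\<Prod>k\<in>I. if k = i \<or> k = j then w k else 1) = (\<Prod>k\<in>{i, j}. w k)"
        using fin ij by (intro prod.mono_neutral_cong_right) auto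
      then show ?thesis using False by simp
    qed
    have "(\<integral>p. u (fst p i, snd p i) * u (fst p j, snd p j) \<partial>pairs I)
        = (\<integral>p. (\<Prod>k\<in>I. ?v k (fst p k, snd p k)) \<partial>pairs I)"
      by (simp only: pr)
    also have "\<dots> = (\<Prod>k\<in>I. \<integral>p. ?v k p \<partial>(M1 \<Otimes>\<^sub>M M2))"
      by (intro expectation_pairs_prod[where B = "\<lambda>_. max B 1"] fin)
        (auto intro: order_trans[OF bnd])
    also have "\<dots> = (\<Prod>k\<in>I. if k = i \<or> k = j then ?m else 1)"
      by (intro prod.cong refl) (simp add: P.prob_space)
    finally show ?thesis using False by (simp add: pr power2_eq_square)
  qed
  have "(\<integral>p. (\<Sum>i\<in>I. u (fst p i, snd p i))\<^sup>2 \<partial>pairs I)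
      = (\<Sum>i\<in>I. \<Sum>j\<in>I. \<integral>p. u (fst p i, snd p i) * u (fst p j, snd p j) \<partial>pairs I)"
    by (simp add: power2_eq_square sum_product intP)
  also have "\<dots> \<le> (\<Sum>i\<in>I. \<Sum>j\<in>I. (if i = j then B\<^sup>2 else 0) + ?m\<^sup>2)"
    by (intro sum_mono cov)
  also have "\<dots> = real (card I) * B\<^sup>2 + (real (card I) * ?m)\<^sup>2"
    using fin by (simp add: sum.distrib power2_eq_square algebra_simps)
  finally show ?thesis .
qed

end

section \<open>Elementary inequalities and the exponential limit\<close>

text \<open>This is nonnegativity of the variance of the absolute value.\<close>

lemma (in prob_space) expectation_abs_le_sqrt:
  fixes X :: "'a \<Rightarrow> real"
  assumes "integrable M X" "integrable M (\<lambda>x. (X x)\<^sup>2)"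
  shows "expectation (\<lambda>x. \<bar>X x\<bar>) \<le> sqrt (expectation (\<lambda>x. (X x)\<^sup>2))"
  using variance_positive[of "\<lambda>x. \<bar>X x\<bar>"] variance_eq[of "\<lambda>x. \<bar>X x\<bar>"] assms
  by (intro real_le_rsqrt) simp

text \<open>For negative \<open>s\<close> this is \<open>1 + s \<le> exp s\<close>; otherwise the
  left side is zero.\<close>

lemma abs_min_one_exp_minus_one_le: "\<bar>min 1 (exp s) - 1\<bar> \<le> \<bar>s\<bar>" for s :: real
proof (cases "0 \<le> s")
  case False
  then show ?thesis using exp_ge_add_one_self[of s] by (simp del: exp_ge_add_one_self)
qed simp

text \<open>Comparison with \<open>(1 - L / d) ^ d\<close>: for bases in the unit interval, d-th
  powers differ by at most \<open>d\<close> times the difference of the bases, here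
  \<open>\<bar>L - d * a d\<bar>\<close>.\<close>

lemma power_one_minus_tendsto_exp:
  fixes a :: "nat \<Rightarrow> real"
  assumes lim: "(\<lambda>d. real d * a d) \<longlonglongrightarrow> L" and a: "\<And>d. 0 \<le> a d" "\<And>d. a d \<le> 1"
  shows "(\<lambda>d. (1 - a d) ^ d) \<longlonglongrightarrow> exp (- L)"
proof -
  have L: "0 \<le> L"
    using a by (intro LIMSEQ_le_const[OF lim]) (auto intro!: exI[of _ 0])
  have "\<bar>(1 - a d) ^ d - (1 + (- L) / real d) ^ d\<bar> \<le> \<bar>L - real d * a d\<bar>"
    \<comment> \<open>With \<open>0 \<le> L\<close>, this puts \<open>1 - L / d\<close> into the
      unit interval, as \<open>norm_power_diff\<close> requires.\<close>
    if d: "d > 0" "L \<le> real d" for d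
  proof -
    have "\<bar>(1 - a d) ^ d - (1 + (- L) / real d) ^ d\<bar>
        \<le> real d * \<bar>(1 - a d) - (1 + (- L) / real d)\<bar>"
      using norm_power_diff[of "1 - a d" "1 + (- L) / real d" d] a[of d] L d
      by (simp add: field_simps)
    also have "\<dots> = \<bar>real d * ((1 - a d) - (1 + (- L) / real d))\<bar>"
      by (simp only: abs_mult abs_of_nat)
    also have "\<dots> = \<bar>L - real d * a d\<bar>"
      by (rule arg_cong[of _ _ abs]) (use d in \<open>simp add: algebra_simps\<close>)
    finally show ?thesis .
  qed
  moreover have "\<forall>\<^sub>F d in sequentially. d > 0 \<and> L \<le> real d"
    by (intro eventually_conj eventually_gt_at_top
      eventually_compose_filterlim[OF eventually_ge_at_top filterlim_real_sequentially])
  ultimately have "\<forall>\<^sub>F d in sequentially.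
      norm ((1 - a d) ^ d - (1 + (- L) / real d) ^ d) \<le> \<bar>L - real d * a d\<bar>"
    by (auto elim: eventually_mono)
  moreover have "(\<lambda>d. \<bar>L - real d * a d\<bar>) \<longlonglongrightarrow> 0"
    using tendsto_rabs[OF tendsto_diff[OF tendsto_const[of L] lim]] by simp
  ultimately have "(\<lambda>d. (1 - a d) ^ d - (1 + (- L) / real d) ^ d) \<longlonglongrightarrow> 0"
    by (rule Lim_null_comparison)
  from tendsto_add[OF this tendsto_exp_limit_sequentially[of "- L"]] show ?thesis by simp
qed

lemma uniform_measure_Icc_eq_density:
  "uniform_measure lborel {-1..1::real} = density lborel (\<lambda>x. ennreal (indicator {-1..1} x / 2))"
  unfolding uniform_measure_def
  by (intro density_cong) (auto simp: indicator_def divide_ennreal[symmetric])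

section \<open>The one-dimensional target density\<close>

locale half_line_density =
  fixes f g g' :: "real \<Rightarrow> real" and c M :: real
  assumes dens: "prob_density f"
    and c_pos: "0 < c"
    and f_pos: "\<And>x. 0 < x \<Longrightarrow> f x = c * exp (g x)"
    and f_nonpos: "\<And>x. x \<le> 0 \<Longrightarrow> f x = 0"
    and g_deriv: "\<And>x. 0 \<le> x \<Longrightarrow> (g has_real_derivative g' x) (at x within {0..})"
    and g'_cont: "continuous_on {0..} g'"
    and g'_bound: "\<And>x. 0 \<le> x \<Longrightarrow> \<bar>g' x\<bar> \<le> M"
begin

abbreviation mu :: "real measure" where "mu \<equiv> density lborel (\<lambda>x. ennreal (f x))"
abbreviation nu :: "real measure" where "nu \<equiv> uniform_measure lborel {-1..1}"

definition G :: "real \<Rightarrow> real" where "G x = g (max 0 x)"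

text \<open>Extending \<open>g\<close> to the whole line and clipping \<open>z\<close> to the support of the proposal make the bound
  on the increments hold everywhere and not only almost everywhere.\<close>

definition incr :: "real \<Rightarrow> real \<times> real \<Rightarrow> real" where
  "incr \<sigma> = (\<lambda>(x, z). G (x + \<sigma> * max (- 1) (min 1 z)) - G x)"

lemma f_meas [measurable]: "f \<in> borel_measurable borel"
  and f_nonneg: "0 \<le> f x"
  using dens by (auto simp: prob_density_def)

lemma M_nonneg: "0 \<le> M"
  using g'_bound[of 0] by simp

lemma prob_mu: "prob_space mu"
  using dens by (intro prob_spaceI) (simp add: emeasure_density prob_density_def)

lemma prob_nu: "prob_space nu"
  by (intro prob_space_uniform_measure) auto

sublocale pair_prob_space mu nu
  by (simp add: pair_prob_space_def pair_sigma_finite_def prob_mu prob_nu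
      prob_space_imp_sigma_finite)

text \<open>The mean value inequality on the convex set \<open>{0..}\<close>, combined with the fact
  that clipping at 0 does not increase distances.\<close>

lemma G_lipschitz: "\<bar>G x - G y\<bar> \<le> M * \<bar>x - y\<bar>"
proof -
  have "norm (g (max 0 x) - g (max 0 y)) \<le> M * norm (max 0 x - max 0 y)"
    by (rule field_differentiable_bound[of "{0..}" g g']) (auto simp: g_deriv g'_bound)
  also have "\<dots> \<le> M * \<bar>x - y\<bar>"
    by (intro mult_left_mono M_nonneg) (auto simp: max_def)
  finally show ?thesis by (simp add: G_def)
qed

lemma G_cont: "continuous_on UNIV G"
  unfolding G_def
proof (rule continuous_on_compose2[of "{0..}" g])
  show "continuous_on {0..} g"
    using g_deriv by (intro DERIV_continuous_on) auto
qed (auto intro!: continuous_intros)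

lemma G_meas [measurable]: "G \<in> borel_measurable borel"
  by (rule borel_measurable_continuous_onI[OF G_cont])

lemma f_eq_G: "0 < x \<Longrightarrow> f x = c * exp (G x)"
  by (simp add: G_def f_pos)

text \<open>Continuity of \<open>G\<close> at 0 makes the one-sided limit exist, so the
  \<open>Lim\<close> in \<open>fstar\<close> is a genuine limit.\<close>

lemma f_tendsto: "(f \<longlongrightarrow> c * exp (G 0)) (at_right 0)"
proof -
  have "(G \<longlongrightarrow> G 0) (at_right 0)"
    using G_cont by (auto simp: continuous_on_def intro: tendsto_within_subset)
  then have "((\<lambda>x. c * exp (G x)) \<longlongrightarrow> c * exp (G 0)) (at_right 0)"
    by (intro tendsto_intros)
  then show ?thesis
    by (rule Lim_transform_eventually)
      (auto simp: f_eq_G intro: eventually_mono[OF eventually_at_right_less])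
qed

lemma fstar_eq: "fstar f = c * exp (G 0)"
  unfolding fstar_def by (intro tendsto_Lim f_tendsto) simp

lemma fstar_pos: "0 < fstar f"
  by (simp add: fstar_eq c_pos)

text \<open>Starting from the boundary value, the logarithm of the density rises with slope at most
  \<open>M\<close>. The bound serves as a dominating constant for the exit probability.\<close>

lemma f_bounded: "f x \<le> fstar f * exp (M * a)" if "x \<le> a" "0 \<le> a"
proof (cases "0 < x")
  case True
  have "M * x \<le> M * a" using that M_nonneg by (intro mult_left_mono)
  moreover have "G x - G 0 \<le> M * x" using G_lipschitz[of x 0] True by simp
  ultimately have "exp (G x) \<le> exp (G 0 + M * a)" by simp
  then show ?thesis using c_pos True by (simp add: f_eq_G fstar_eq exp_add)
next
  case False
  then show ?thesis using fstar_pos by (simp add: f_nonpos)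
qed

section \<open>Increments of the log density\<close>

lemma incr_meas [measurable]: "incr \<sigma> \<in> borel_measurable (mu \<Otimes>\<^sub>M nu)"
  unfolding incr_def by measurable

lemma AE_mu_pos: "AE x in mu. 0 < x"
proof (subst AE_density)
  show "AE x in lborel. 0 < ennreal (f x) \<longrightarrow> 0 < x"
    using f_nonpos by (intro AE_I2) (metis ennreal_0 less_irrefl not_le)
qed simp

lemma AE_nu_bounded: "AE z in nu. \<bar>z\<bar> \<le> 1"
  by (rule AE_uniform_measureI) (auto intro!: AE_I2)

lemma AE_pair_range: "AE p in mu \<Otimes>\<^sub>M nu. 0 < fst p \<and> \<bar>snd p\<bar> \<le> 1"
proof (rule AE_pair_measure)
  show "{p \<in> space (mu \<Otimes>\<^sub>M nu). 0 < fst p \<and> \<bar>snd p\<bar> \<le> 1} \<in> sets (mu \<Otimes>\<^sub>M nu)"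
    by measurable
  show "AE x in mu. AE z in nu. 0 < fst (x, z) \<and> \<bar>snd (x, z)\<bar> \<le> 1"
    using AE_mu_pos by eventually_elim (use AE_nu_bounded in auto)
qed

lemma incr_bound: "\<bar>incr \<sigma> p\<bar> \<le> M * \<bar>\<sigma>\<bar>"
proof -
  obtain x z where p: "p = (x, z)" by force
  have "\<bar>incr \<sigma> p\<bar> \<le> M * \<bar>\<sigma> * max (- 1) (min 1 z)\<bar>"
    using G_lipschitz[of "x + \<sigma> * max (- 1) (min 1 z)" x] by (simp add: p incr_def)
  also have "\<dots> \<le> M * (\<bar>\<sigma>\<bar> * 1)"
    unfolding abs_mult by (intro mult_left_mono M_nonneg) auto
  finally show ?thesis by simp
qed

lemma sum_incr_bound: "\<bar>\<Sum>i<d. incr \<sigma> (x i, z i)\<bar> \<le> real d * (M * \<bar>\<sigma>\<bar>)"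
  by (rule order_trans[OF sum_abs])
    (use sum_bounded_above[of "{..<d}" "\<lambda>i. \<bar>incr \<sigma> (x i, z i)\<bar>" "M * \<bar>\<sigma>\<bar>"] incr_bound in simp)

lemma sum_incr_integrable:
  "integrable (pairs {..<d}) (\<lambda>p. \<Sum>i<d. incr \<sigma> (fst p i, snd p i))"
  for d :: nat
proof -
  interpret Q: prob_space "pairs {..<d}" by (rule prob_space_pairs)
  show ?thesis
  proof (rule Q.integrable_const_bound[where B = "real d * (M * \<bar>\<sigma>\<bar>)"])
    show "AE p in pairs {..<d}.
        norm (\<Sum>i<d. incr \<sigma> (fst p i, snd p i)) \<le> real d * (M * \<bar>\<sigma>\<bar>)"
      unfolding real_norm_def by (intro AE_I2 sum_incr_bound)
  qed measurable
qed

lemma expectation_nu_id: "(\<integral>z. z \<partial>nu) = 0"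
proof -
  have eq: "(\<integral>z. z \<partial>nu) = (\<integral>z. indicator {-1..1} z / 2 * z \<partial>lborel)"
    unfolding uniform_measure_Icc_eq_density by (subst integral_density) auto
  note eq
  \<comment> \<open>The reflection of \<open>z\<close> to \<open>- z\<close> preserves the density,
    so the integral equals its own negative.\<close>
  also have "\<dots> = (\<integral>z. - (indicator {-1..1} z / 2 * z) \<partial>lborel)"
    by (subst lborel_integral_real_affine[of "-1" _ 0])
      (auto simp: indicator_def intro!: Bochner_Integration.integral_cong)
  finally have "(\<integral>z. z \<partial>nu) = - (\<integral>z. indicator {-1..1} z / 2 * z \<partial>lborel)"
    by (simp only: integral_minus)
  with eq show ?thesis by linarith
qed

text \<open>Multiplied by \<open>d\<close>, the increment is a difference quotient with limit
  \<open>l * g' x * z\<close> and is bounded by \<open>M * l\<close>. The limit integrates to zero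
  because \<open>z\<close> is centred under \<open>nu\<close>.\<close>

lemma expectation_incr_tendsto:
  assumes l: "0 < l"
  shows "(\<lambda>d. real d * (\<integral>p. incr (l / real d) p \<partial>(mu \<Otimes>\<^sub>M nu))) \<longlonglongrightarrow> 0"
proof -
  \<comment> \<open>A continuous, hence measurable, extension of \<open>g'\<close> to the line; it
    is used as the derivative of \<open>G\<close> only at positive points.\<close>
  define h where "h x = g' (max 0 x)" for x
  have "continuous_on UNIV h"
    unfolding h_def by (rule continuous_on_compose2[OF g'_cont]) (auto intro!: continuous_intros)
  then have [measurable]: "h \<in> borel_measurable borel"
    by (rule borel_measurable_continuous_onI)
  have h_bound: "\<bar>h x\<bar> \<le> M" for x by (simp add: h_def g'_bound)
  have "(\<lambda>d. \<integral>p. real d * incr (l / real d) p \<partial>(mu \<Otimes>\<^sub>M nu))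
      \<longlonglongrightarrow> (\<integral>p. l * h (fst p) * snd p \<partial>(mu \<Otimes>\<^sub>M nu))"
  proof (rule integral_dominated_convergence[where w = "\<lambda>_. M * l"])
    show "AE p in mu \<Otimes>\<^sub>M nu. (\<lambda>d. real d * incr (l / real d) p) \<longlonglongrightarrow> l * h (fst p) * snd p"
      using AE_pair_range
    proof eventually_elim
      case (elim p)
      obtain x z where p: "p = (x, z)" by force
      with elim have x: "0 < x" and z: "max (- 1) (min 1 z) = z" by auto
      have "(g has_real_derivative g' x) (at x)"
        using g_deriv[of x] x by (simp add: at_within_interior[of x "{0..}"] interior_real_atLeast)
      moreover have "\<forall>\<^sub>F y in nhds x. g y = G y"
        using eventually_nhds_in_open[of "{0<..}" x] x by (auto simp: G_def elim: eventually_mono)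
      ultimately have "(G has_real_derivative h x) (at x)"
        using x by (simp add: h_def DERIV_cong_ev)
      \<comment> \<open>At \<open>t = 1 / d\<close> the difference quotient of this function at 0 is
        the scaled increment.\<close>
      then have "((\<lambda>t. G (x + l * z * t)) has_real_derivative h x * (l * z)) (at 0)"
        by (auto intro!: derivative_eq_intros DERIV_chain2[of G])
      then have "((\<lambda>t. (G (x + l * z * t) - G x) / t) \<longlongrightarrow> h x * (l * z)) (at 0)"
        by (simp add: has_field_derivative_iff)
      moreover have "filterlim (\<lambda>d. 1 / real d) (at 0) sequentially"
        by (rule filterlim_atI[OF lim_1_over_n])
          (auto intro: eventually_mono[OF eventually_gt_at_top[of 0]])
      ultimately have "(\<lambda>d. (G (x + l * z * (1 / real d)) - G x) / (1 / real d)) \<longlonglongrightarrow> h x * (l * z)"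
        by (rule filterlim_compose)
      then show ?case by (simp add: p incr_def z mult_ac)
    qed
    show "AE p in mu \<Otimes>\<^sub>M nu. norm (real d * incr (l / real d) p) \<le> M * l" for d
    proof (rule AE_I2)
      fix p
      have "\<bar>real d * incr (l / real d) p\<bar> \<le> real d * (M * \<bar>l / real d\<bar>)"
        using incr_bound[of "l / real d" p] by (simp add: abs_mult mult_left_mono del: abs_divide)
      also have "\<dots> \<le> M * l"
        \<comment> \<open>For \<open>d = 0\<close> the left side is zero; otherwise \<open>d\<close>
          cancels.\<close>
        using l M_nonneg by (cases "d = 0") auto
      finally show "norm (real d * incr (l / real d) p) \<le> M * l" by simp
    qed
  qed (simp_all add: P.prob_space)
  moreover have "(\<integral>p. l * h (fst p) * snd p \<partial>(mu \<Otimes>\<^sub>M nu)) = 0"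
  proof -
    have "integrable (mu \<Otimes>\<^sub>M nu) (\<lambda>p. l * h (fst p) * snd p)"
    proof (rule P.integrable_const_bound[where B = "l * M"])
      show "AE p in mu \<Otimes>\<^sub>M nu. norm (l * h (fst p) * snd p) \<le> l * M"
        using AE_pair_range
      proof eventually_elim
        case (elim p)
        have "\<bar>h (fst p)\<bar> * \<bar>snd p\<bar> \<le> M * 1"
          using elim by (intro mult_mono h_bound) (auto simp: M_nonneg)
        then show ?case using l by (simp add: abs_mult)
      qed
    qed measurable
    from integral_fst'[OF this]
    show ?thesis by (simp add: expectation_nu_id)
  qed
  ultimately show ?thesis by simp
qed

section \<open>The probability of leaving the half-line\<close>

text \<open>Real-valued, so that the event that every coordinate stays positive becomes a product
  over coordinates.\<close>

definition stays :: "real \<Rightarrow> real \<times> real \<Rightarrow> real" where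
  "stays \<sigma> = (\<lambda>(x, z). of_bool (0 < x + \<sigma> * z))"

lemma stays_meas [measurable]: "stays \<sigma> \<in> borel_measurable (mu \<Otimes>\<^sub>M nu)"
  unfolding stays_def by measurable

lemma stays_range: "0 \<le> stays \<sigma> p" "stays \<sigma> p \<le> 1"
  by (auto simp: stays_def split_beta)

text \<open>Leaving means \<open>z \<le> - x / \<sigma>\<close>. The part of \<open>{-1..1}\<close>
  below that point has length \<open>1 - x / \<sigma>\<close>, or is null if this is negative, and
  the uniform density is 1/2.\<close>

lemma nu_exits:
  assumes "0 < x" "0 < \<sigma>"
  shows "(\<integral>z. 1 - stays \<sigma> (x, z) \<partial>nu) = max 0 (1 - x / \<sigma>) / 2"
proof -
  have "(\<integral>z. 1 - stays \<sigma> (x, z) \<partial>nu) = (\<integral>z. indicator {..- x / \<sigma>} z \<partial>nu)"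
    using assms by (intro Bochner_Integration.integral_cong)
      (auto simp: stays_def indicator_def field_simps)
  also have "\<dots> = measure lborel ({-1..1} \<inter> {..- x / \<sigma>}) / 2"
    by (simp add: measure_uniform_measure)
  also have "{-1..1} \<inter> {..- x / \<sigma>} = {-1..- x / \<sigma>}"
  proof -
    have "- x / \<sigma> \<le> 1" using divide_pos_pos[OF assms] by linarith
    then show ?thesis by auto
  qed
  also have "measure lborel {-1..- x / \<sigma>} = max 0 (1 - x / \<sigma>)"
  proof (cases "x \<le> \<sigma>")
    case True
    then have "x / \<sigma> \<le> 1" using assms by simp
    then show ?thesis by simp
  next
    case False
    then have "1 < x / \<sigma>" using assms by simp
    then show ?thesis by simp
  qed
  finally show ?thesis .
qed

text \<open>Fubini reduces this to \<open>nu_exits\<close>. Substituting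
  \<open>x = \<sigma> * y\<close> then extracts the factor \<open>\<sigma>\<close> and makes the
  weight independent of \<open>\<sigma>\<close>.\<close>

lemma prob_exits_eq:
  assumes \<sigma>: "0 < \<sigma>"
  shows "1 - (\<integral>p. stays \<sigma> p \<partial>(mu \<Otimes>\<^sub>M nu)) = \<sigma> * (\<integral>y. f (\<sigma> * y) * (max 0 (1 - y) / 2) \<partial>lborel)"
proof -
  have int: "integrable (mu \<Otimes>\<^sub>M nu) (\<lambda>p. 1 - stays \<sigma> p)"
    using stays_range by (intro P.integrable_const_bound[where B = 1]) auto
  have int': "integrable (mu \<Otimes>\<^sub>M nu) (stays \<sigma>)"
    using stays_range by (intro P.integrable_const_bound[where B = 1]) auto
  have "1 - (\<integral>p. stays \<sigma> p \<partial>(mu \<Otimes>\<^sub>M nu)) = (\<integral>p. 1 - stays \<sigma> p \<partial>(mu \<Otimes>\<^sub>M nu))"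
    using int' by (simp add: P.prob_space)
  also have "\<dots> = (\<integral>x. \<integral>z. 1 - stays \<sigma> (x, z) \<partial>nu \<partial>mu)"
    by (rule integral_fst'[OF int, symmetric])
  also have "\<dots> = (\<integral>x. f x * (\<integral>z. 1 - stays \<sigma> (x, z) \<partial>nu) \<partial>lborel)"
    using borel_measurable_integrable[OF integrable_fst'[OF int]]
    by (subst integral_density) (auto simp: f_nonneg)
  \<comment> \<open>Where \<open>nu_exits\<close> does not apply, at \<open>x \<le> 0\<close>, both
    integrands vanish with \<open>f\<close>.\<close>
  also have "\<dots> = (\<integral>x. f x * (max 0 (1 - x / \<sigma>) / 2) \<partial>lborel)"
    using \<sigma> by (intro Bochner_Integration.integral_cong refl)
      (metis f_nonpos mult_zero_left not_le nu_exits)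
  also have "\<dots> = \<sigma> * (\<integral>y. f (\<sigma> * y) * (max 0 (1 - y) / 2) \<partial>lborel)"
    using \<sigma> by (subst lborel_integral_real_affine[of \<sigma> _ 0]) auto
  finally show ?thesis .
qed

text \<open>For \<open>y > 0\<close> the values \<open>f (l / d * y)\<close> tend to
  \<open>fstar f\<close>, so the integral in \<open>prob_exits_eq\<close> tends to
  \<open>fstar f\<close> times the integral of \<open>(1 - y) / 2\<close> over the unit interval.
  That integral is the source of the 1/4.\<close>

lemma prob_exits_tendsto:
  assumes l: "0 < l"
  shows "(\<lambda>d. real d * (1 - (\<integral>p. stays (l / real d) p \<partial>(mu \<Otimes>\<^sub>M nu)))) \<longlonglongrightarrow> fstar f * l / 4"
proof -
  let ?q = "\<lambda>y::real. max 0 (1 - y) / 2"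
  have "(\<lambda>d. \<integral>y. f (l / real d * y) * ?q y \<partial>lborel)
      \<longlonglongrightarrow> (\<integral>y. fstar f * (indicator {0..1} y *\<^sub>R ((1 - y) / 2)) \<partial>lborel)"
  proof (rule integral_dominated_convergence
      [where w = "\<lambda>y. indicator {0..1} y *\<^sub>R (fstar f * exp (M * l))"])
    \<comment> \<open>At \<open>y = 0\<close> convergence fails: \<open>f 0\<close> is zero, while
      the limit integrand is \<open>fstar f / 2\<close>.\<close>
    have "AE y in lborel. y \<noteq> (0::real)" by (rule AE_lborel_singleton)
    then show "AE y in lborel. (\<lambda>d. f (l / real d * y) * ?q y)
        \<longlonglongrightarrow> fstar f * (indicator {0..1} y *\<^sub>R ((1 - y) / 2))"
    proof eventually_elim
      case (elim y)
      show ?case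
      proof (cases "0 < y")
        case True
        have "filterlim (\<lambda>d. l / real d * y) (at_right 0) sequentially"
        proof (rule tendsto_imp_filterlim_at_right)
          show "(\<lambda>d. l / real d * y) \<longlonglongrightarrow> 0"
            using tendsto_mult_left[OF lim_1_over_n, of "l * y"] by simp
          show "\<forall>\<^sub>F d in sequentially. 0 < l / real d * y"
            using eventually_gt_at_top[of 0] by eventually_elim (use l True in simp)
        qed
        then have "(\<lambda>d. f (l / real d * y)) \<longlonglongrightarrow> fstar f"
          unfolding fstar_eq by (rule filterlim_compose[OF f_tendsto])
        then have "(\<lambda>d. f (l / real d * y) * ?q y) \<longlonglongrightarrow> fstar f * ?q y"
          by (rule tendsto_mult_right)
        then show ?thesis using True by (auto simp: indicator_def max_def)
      next
        case False
        then have "f (l / real d * y) = 0" for d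
          using l by (intro f_nonpos) (simp add: divide_le_0_iff mult_le_0_iff)
        then show ?thesis using False elim by simp
      qed
    qed
    show "AE y in lborel. norm (f (l / real d * y) * ?q y)
        \<le> indicator {0..1} y *\<^sub>R (fstar f * exp (M * l))" for d
    proof (rule AE_I2)
      fix y :: real
      consider "y < 0" | "1 < y" | "0 \<le> y" "y \<le> 1" by linarith
      then show "norm (f (l / real d * y) * ?q y) \<le> indicator {0..1} y *\<^sub>R (fstar f * exp (M * l))"
      proof cases
        case 1
        then have "f (l / real d * y) = 0"
          using l by (intro f_nonpos) (simp add: divide_le_0_iff mult_le_0_iff)
        then show ?thesis using 1 by simp
      next
        case 3
        \<comment> \<open>Even \<open>d = 0\<close> satisfies this, as \<open>l / 0\<close> is 0, so
          \<open>f_bounded\<close> at \<open>a = l\<close> gives one dominating function for all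
          \<open>d\<close>.\<close>
        have "l / real d * y \<le> l * 1"
          using l 3 by (intro mult_mono) (cases "d = 0"; simp add: divide_le_eq)+
        then have "f (l / real d * y) \<le> fstar f * exp (M * l)"
          using l by (intro f_bounded) auto
        then have "f (l / real d * y) * ?q y \<le> fstar f * exp (M * l) * 1"
          using 3 f_nonneg fstar_pos by (intro mult_mono) auto
        then show ?thesis using 3 f_nonneg by simp
      qed simp
    qed
    show "integrable lborel (\<lambda>y. indicator {0..1::real} y *\<^sub>R (fstar f * exp (M * l)))"
      by (intro integrable_scaleR_left integrable_real_indicator) auto
  qed simp_all
  moreover have "(\<integral>y. indicator {0..1} y *\<^sub>R ((1 - y) / 2) \<partial>lborel) = (1 / 4 :: real)"
    by (subst integral_FTC_Icc[where F = "\<lambda>y. y / 2 - y\<^sup>2 / 4"])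
      (auto intro!: derivative_eq_intros continuous_intros
        simp: has_real_derivative_iff_has_vector_derivative[symmetric] field_simps)
  ultimately have "(\<lambda>d. \<integral>y. f (l / real d * y) * ?q y \<partial>lborel) \<longlonglongrightarrow> fstar f * (1 / 4)"
    by (simp only: integral_mult_right_zero)
  from tendsto_mult_left[OF this, of l]
  have "(\<lambda>d. l * (\<integral>y. f (l / real d * y) * ?q y \<partial>lborel)) \<longlonglongrightarrow> fstar f * l / 4"
    by (simp add: mult_ac)
  then show ?thesis
  proof (rule Lim_transform_eventually)
    show "\<forall>\<^sub>F d in sequentially. l * (\<integral>y. f (l / real d * y) * ?q y \<partial>lborel)
        = real d * (1 - (\<integral>p. stays (l / real d) p \<partial>(mu \<Otimes>\<^sub>M nu)))"
      using eventually_gt_at_top[of 0] by eventually_elim (use l in \<open>simp add: prob_exits_eq\<close>)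
  qed
qed

section \<open>Limits for all coordinates together\<close>

text \<open>By independence the expectation is a d-th power. Writing its base as 1 minus the exit
  probability brings it into the form of \<open>power_one_minus_tendsto_exp\<close>.\<close>

lemma expectation_stays_prod_tendsto:
  assumes l: "0 < l"
  shows "(\<lambda>d. \<integral>p. (\<Prod>i<d. stays (l / real d) (fst p i, snd p i)) \<partial>pairs {..<d})
    \<longlonglongrightarrow> exp (- (fstar f * l / 4))"
proof -
  have int: "integrable (mu \<Otimes>\<^sub>M nu) (stays \<sigma>)" for \<sigma>
    using stays_range by (intro P.integrable_const_bound[where B = 1]) auto
  have "(\<integral>p. (\<Prod>i<d. stays (l / real d) (fst p i, snd p i)) \<partial>pairs {..<d})
      = (1 - (1 - (\<integral>p. stays (l / real d) p \<partial>(mu \<Otimes>\<^sub>M nu)))) ^ d" for d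
    using stays_range by (subst expectation_pairs_prod[where B = "\<lambda>_. 1"]) auto
  moreover have "(\<integral>p. stays \<sigma> p \<partial>(mu \<Otimes>\<^sub>M nu)) \<le> 1" for \<sigma>
    using int stays_range by (intro P.integral_le_const) auto
  moreover have "0 \<le> (\<integral>p. stays \<sigma> p \<partial>(mu \<Otimes>\<^sub>M nu))" for \<sigma>
    using stays_range by (intro integral_nonneg_AE) auto
  ultimately show ?thesis
    using power_one_minus_tendsto_exp[OF prob_exits_tendsto[OF l]] by simp
qed

text \<open>The second moment bound with \<open>B = M * l / d\<close> has a diagonal part
  \<open>(M * l)\<^sup>2 / d\<close> and a mean part that vanishes by
  \<open>expectation_incr_tendsto\<close>.\<close>

lemma expectation_abs_sum_incr_tendsto:
  assumes l: "0 < l"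
  shows "(\<lambda>d. \<integral>p. \<bar>\<Sum>i<d. incr (l / real d) (fst p i, snd p i)\<bar> \<partial>pairs {..<d}) \<longlonglongrightarrow> 0"
proof -
  let ?S = "\<lambda>d p. \<Sum>i<d. incr (l / real d) (fst p i, snd p i)"
  let ?m = "\<lambda>d. \<integral>p. incr (l / real d) p \<partial>(mu \<Otimes>\<^sub>M nu)"
  have "(\<integral>p. \<bar>?S d p\<bar> \<partial>pairs {..<d}) \<le> sqrt ((M * l)\<^sup>2 * (1 / real d) + (real d * ?m d)\<^sup>2)" for d
  proof -
    interpret Q: prob_space "pairs {..<d}" by (rule prob_space_pairs)
    have "integrable (pairs {..<d}) (\<lambda>p. (?S d p)\<^sup>2)"
    proof (rule Q.integrable_const_bound[where B = "(real d * (M * \<bar>l / real d\<bar>))\<^sup>2"])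
      show "AE p in pairs {..<d}. norm ((?S d p)\<^sup>2) \<le> (real d * (M * \<bar>l / real d\<bar>))\<^sup>2"
      proof (rule AE_I2)
        fix p
        show "norm ((?S d p)\<^sup>2) \<le> (real d * (M * \<bar>l / real d\<bar>))\<^sup>2"
          using power_mono[OF sum_incr_bound[where d = d and \<sigma> = "l / real d"
                and x = "fst p" and z = "snd p"] abs_ge_zero, of 2]
          by (simp only: real_norm_def power2_abs abs_power2)
      qed
    qed measurable
    with sum_incr_integrable[where d = d and \<sigma> = "l / real d"]
    have "(\<integral>p. \<bar>?S d p\<bar> \<partial>pairs {..<d}) \<le> sqrt (\<integral>p. (?S d p)\<^sup>2 \<partial>pairs {..<d})"
      by (rule Q.expectation_abs_le_sqrt)
    also have "\<dots> \<le> sqrt (real (card {..<d}) * (M * \<bar>l / real d\<bar>)\<^sup>2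
        + (real (card {..<d}) * ?m d)\<^sup>2)"
      by (intro real_sqrt_le_mono expectation_pairs_sum_square incr_bound) auto
    also have "real (card {..<d}) * (M * \<bar>l / real d\<bar>)\<^sup>2 = (M * l)\<^sup>2 * (1 / real d)"
      by (simp add: power2_eq_square)
    finally show ?thesis by simp
  qed
  moreover have "(\<lambda>d. sqrt ((M * l)\<^sup>2 * (1 / real d) + (real d * ?m d)\<^sup>2))
      \<longlonglongrightarrow> sqrt ((M * l)\<^sup>2 * 0 + 0\<^sup>2)"
    by (intro tendsto_intros lim_1_over_n expectation_incr_tendsto l)
  then have "(\<lambda>d. sqrt ((M * l)\<^sup>2 * (1 / real d) + (real d * ?m d)\<^sup>2)) \<longlonglongrightarrow> 0"
    by simp
  ultimately show ?thesis
    by - (rule Lim_null_comparison, rule always_eventually, auto)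
qed

section \<open>The expected acceptance probability\<close>

lemma target_law_eq: "target_law f d = Pi\<^sub>M {..<d} (\<lambda>_. mu)"
proof -
  interpret product_sigma_finite "\<lambda>_::nat. lborel :: real measure" by standard
  have "target_law f d
      = density (Pi\<^sub>M {..<d} (\<lambda>_. lborel)) (\<lambda>x. \<Prod>i<d. ennreal (f (x i)))"
    by (simp add: target_law_def target_def prod_ennreal f_nonneg)
  also have "\<dots> = Pi\<^sub>M {..<d} (\<lambda>_. mu)"
    by (rule density_PiM) (auto intro: prob_space_imp_sigma_finite prob_mu)
  finally show ?thesis .
qed

text \<open>In each coordinate the ratio of densities is zero after an exit; otherwise
  \<open>c\<close> cancels and the exponential of the increment remains. The product of the
  \<open>stays\<close> factors is 0 or 1, so it can be moved out of the minimum.\<close>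

lemma acceptance_ratio_eq:
  assumes x: "\<And>i. i < d \<Longrightarrow> 0 < x i" and z: "\<And>i. i < d \<Longrightarrow> \<bar>z i\<bar> \<le> 1"
  shows "min 1 (target f d (\<lambda>i. x i + \<sigma> * z i) / target f d x)
    = (\<Prod>i<d. stays \<sigma> (x i, z i)) * min 1 (exp (\<Sum>i<d. incr \<sigma> (x i, z i)))"
proof -
  have "f (x i + \<sigma> * z i) / f (x i) = stays \<sigma> (x i, z i) * exp (incr \<sigma> (x i, z i))" if "i < d" for i
  proof -
    \<comment> \<open>Within the proposal range the clipping in \<open>incr\<close> has no
      effect.\<close>
    have "max (- 1) (min 1 (z i)) = z i" using z[OF that] by auto
    then show ?thesis
      using x[OF that] c_pos
      by (cases "0 < x i + \<sigma> * z i") (auto simp: stays_def incr_def f_eq_G f_nonpos exp_diff)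
  qed
  then have "target f d (\<lambda>i. x i + \<sigma> * z i) / target f d x
      = (\<Prod>i<d. stays \<sigma> (x i, z i)) * exp (\<Sum>i<d. incr \<sigma> (x i, z i))"
    by (simp add: target_def prod_dividef[symmetric] prod.distrib exp_sum)
  moreover have "(\<Prod>i<d. stays \<sigma> (x i, z i)) = of_bool (\<forall>i<d. 0 < x i + \<sigma> * z i)"
    by (auto simp: stays_def intro!: prod_zero)
  ultimately show ?thesis by simp
qed

text \<open>Almost surely the current state is positive and the noise lies in its range, so
  \<open>acceptance_ratio_eq\<close> rewrites the inner integrand; Fubini then joins the two
  integrals.\<close>

lemma expected_acceptance_eq:
  "(\<integral>x. accept_prob f \<sigma> d x \<partial>target_law f d)
    = (\<integral>p. (\<Prod>i<d. stays \<sigma> (fst p i, snd p i))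
        * min 1 (exp (\<Sum>i<d. incr \<sigma> (fst p i, snd p i))) \<partial>pairs {..<d})"
proof -
  let ?K = "\<lambda>p. (\<Prod>i<d. stays \<sigma> (fst p i, snd p i)) * min 1 (exp (\<Sum>i<d. incr \<sigma> (fst p i, snd p i)))"
  interpret Q: pair_prob_space "Pi\<^sub>M {..<d} (\<lambda>_. mu)" "Pi\<^sub>M {..<d} (\<lambda>_. nu)"
    by (rule pair_prob_space_pairs)
  have K_int: "integrable (pairs {..<d}) ?K"
  proof (rule Q.P.integrable_const_bound[where B = 1])
    have "0 \<le> (\<Prod>i<d. stays \<sigma> (fst p i, snd p i))" "(\<Prod>i<d. stays \<sigma> (fst p i, snd p i)) \<le> 1" for p
      by (auto intro!: prod_nonneg prod_le_1 stays_range)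
    then show "AE p in pairs {..<d}. norm (?K p) \<le> 1"
      by (intro AE_I2) (auto simp: abs_mult intro!: mult_le_one)
  qed measurable
  have x_pos: "AE x in Pi\<^sub>M {..<d} (\<lambda>_. mu). \<forall>i\<in>{..<d}. 0 < x i"
    by (intro AE_finite_allI AE_PiM_component prob_mu AE_mu_pos) auto
  have z_range: "AE z in Pi\<^sub>M {..<d} (\<lambda>_. nu). \<forall>i\<in>{..<d}. \<bar>z i\<bar> \<le> 1"
    by (intro AE_finite_allI AE_PiM_component prob_nu AE_nu_bounded) auto
  have "AE x in Pi\<^sub>M {..<d} (\<lambda>_. mu).
      accept_prob f \<sigma> d x = (\<integral>z. ?K (x, z) \<partial>Pi\<^sub>M {..<d} (\<lambda>_. nu))"
    using x_pos AE_space
  proof eventually_elim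
    case (elim x)
    have "AE z in Pi\<^sub>M {..<d} (\<lambda>_. nu).
        min 1 (target f d (\<lambda>i. x i + \<sigma> * z i) / target f d x) = ?K (x, z)"
      using z_range by eventually_elim (use elim in \<open>simp add: acceptance_ratio_eq\<close>)
    then show ?case
      unfolding accept_prob_def proposal_law_def
    proof (intro integral_cong_AE)
      show "(\<lambda>z. min 1 (target f d (\<lambda>i. x i + \<sigma> * z i) / target f d x))
          \<in> borel_measurable (Pi\<^sub>M {..<d} (\<lambda>_. nu))"
        unfolding target_def by measurable
      show "(\<lambda>z. ?K (x, z)) \<in> borel_measurable (Pi\<^sub>M {..<d} (\<lambda>_. nu))"
        using elim by measurable
    qed
  qed
  moreover have "accept_prob f \<sigma> d \<in> borel_measurable (Pi\<^sub>M {..<d} (\<lambda>_. mu))"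
    unfolding accept_prob_def[abs_def] proposal_law_def target_def by measurable
  ultimately have "(\<integral>x. accept_prob f \<sigma> d x \<partial>target_law f d)
      = (\<integral>x. \<integral>z. ?K (x, z) \<partial>Pi\<^sub>M {..<d} (\<lambda>_. nu) \<partial>Pi\<^sub>M {..<d} (\<lambda>_. mu))"
    unfolding target_law_eq using borel_measurable_integrable[OF Q.integrable_fst'[OF K_int]]
    by (intro integral_cong_AE) auto
  also have "\<dots> = (\<integral>p. ?K p \<partial>pairs {..<d})"
    by (rule Q.integral_fst'[OF K_int])
  finally show ?thesis .
qed

lemma expected_acceptance_tendsto:
  assumes l: "0 < l"
  shows "(\<lambda>d. \<integral>x. accept_prob f (l / real d) d x \<partial>target_law f d) \<longlonglongrightarrow> acc_limit f l"
proof -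
  let ?A = "\<lambda>d p. \<Prod>i<d. stays (l / real d) (fst p i, snd p i)"
  let ?S = "\<lambda>d p. \<Sum>i<d. incr (l / real d) (fst p i, snd p i)"
  have "\<bar>(\<integral>x. accept_prob f (l / real d) d x \<partial>target_law f d) - (\<integral>p. ?A d p \<partial>pairs {..<d})\<bar>
      \<le> (\<integral>p. \<bar>?S d p\<bar> \<partial>pairs {..<d})" for d
  proof -
    interpret Q: prob_space "pairs {..<d}" by (rule prob_space_pairs)
    have A: "0 \<le> ?A d p" "?A d p \<le> 1" for p
      by (auto intro!: prod_nonneg prod_le_1 stays_range)
    have intA: "integrable (pairs {..<d}) (?A d)"
      using A by (intro Q.integrable_const_bound[where B = 1]) auto
    have intK: "integrable (pairs {..<d}) (\<lambda>p. ?A d p * min 1 (exp (?S d p)))"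
      using A by (intro Q.integrable_const_bound[where B = 1])
        (auto simp: abs_mult intro!: mult_le_one AE_I2)
    have intD: "integrable (pairs {..<d}) (\<lambda>p. ?A d p * (min 1 (exp (?S d p)) - 1))"
      unfolding right_diff_distrib mult_1_right
      by (rule Bochner_Integration.integrable_diff[OF intK intA])
    have "\<bar>(\<integral>x. accept_prob f (l / real d) d x \<partial>target_law f d) - (\<integral>p. ?A d p \<partial>pairs {..<d})\<bar>
        = \<bar>\<integral>p. ?A d p * (min 1 (exp (?S d p)) - 1) \<partial>pairs {..<d}\<bar>"
      using intA intK
      by (simp add: expected_acceptance_eq right_diff_distrib Bochner_Integration.integral_diff)
    also have "\<dots> \<le> (\<integral>p. \<bar>?A d p * (min 1 (exp (?S d p)) - 1)\<bar> \<partial>pairs {..<d})"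
      by (rule integral_abs_bound)
    also have "\<dots> \<le> (\<integral>p. \<bar>?S d p\<bar> \<partial>pairs {..<d})"
    proof (rule integral_mono)
      show "integrable (pairs {..<d}) (\<lambda>p. \<bar>?A d p * (min 1 (exp (?S d p)) - 1)\<bar>)"
        by (rule integrable_abs[OF intD])
      \<comment> \<open>Replacing the truncated exponential by 1 costs at most the absolute log
        ratio, on the event encoded by \<open>?A\<close>.\<close>
      show "\<bar>?A d p * (min 1 (exp (?S d p)) - 1)\<bar> \<le> \<bar>?S d p\<bar>" for p
      proof -
        have "\<bar>?A d p * (min 1 (exp (?S d p)) - 1)\<bar> = ?A d p * \<bar>min 1 (exp (?S d p)) - 1\<bar>"
          by (simp only: abs_mult abs_of_nonneg[OF A(1)])
        also have "\<dots> \<le> 1 * \<bar>?S d p\<bar>"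
          by (intro mult_mono A abs_min_one_exp_minus_one_le) auto
        finally show ?thesis by simp
      qed
    qed (intro integrable_abs sum_incr_integrable)
    finally show ?thesis .
  qed
  then have "(\<lambda>d. (\<integral>x. accept_prob f (l / real d) d x \<partial>target_law f d)
      - (\<integral>p. ?A d p \<partial>pairs {..<d})) \<longlonglongrightarrow> 0"
    by (intro Lim_null_comparison[OF always_eventually expectation_abs_sum_incr_tendsto[OF l]]) simp
  from tendsto_add[OF this expectation_stays_prod_tendsto[OF l]] show ?thesis
    by (simp add: acc_limit_def)
qed

end

section \<open>The optimal scaling and its acceptance rate\<close>

text \<open>In units of the claimed maximiser, \<open>y = 8 / fstar f * t\<close>, the speed is a
  constant times \<open>t\<^sup>2 * exp (- 2 * t)\<close>. Squaring
  \<open>t \<le> exp (t - 1)\<close> bounds this by its value at \<open>t = 1\<close>.\<close>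

lemma speed_is_arg_max:
  assumes F: "0 < fstar f"
  shows "is_arg_max (speed f) (\<lambda>l. 0 < l) (8 / fstar f)"
proof -
  have "speed f y \<le> speed f (8 / fstar f)" if y: "0 < y" for y
  proof -
    define t where "t = fstar f * y / 8"
    have t: "0 < t" "y = 8 / fstar f * t" using F y by (simp_all add: t_def)
    have "t \<le> exp (t - 1)" using exp_ge_add_one_self[of "t - 1"] by simp
    then have "t\<^sup>2 \<le> (exp (t - 1))\<^sup>2" using t by (intro power_mono) auto
    also have "\<dots> = exp (2 * t - 2)" by (simp add: exp_double[symmetric] right_diff_distrib)
    finally have "t\<^sup>2 * exp (- 2 * t) \<le> exp (2 * t - 2) * exp (- 2 * t)"
      by (intro mult_right_mono) auto
    also have "\<dots> = exp (- 2)" by (simp add: exp_add[symmetric])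
    finally have "(8 / fstar f)\<^sup>2 / 3 * (t\<^sup>2 * exp (- 2 * t)) \<le> (8 / fstar f)\<^sup>2 / 3 * exp (- 2)"
      by (intro mult_left_mono) auto
    moreover have "speed f y = (8 / fstar f)\<^sup>2 / 3 * (t\<^sup>2 * exp (- 2 * t))"
      using F by (simp add: speed_def t(2) power_mult_distrib power_divide)
    moreover have "speed f (8 / fstar f) = (8 / fstar f)\<^sup>2 / 3 * exp (- 2)"
      using F by (simp add: speed_def)
    ultimately show ?thesis by simp
  qed
  then show ?thesis using F by (force simp: is_arg_max_def not_less)
qed

lemma exp_minus_two_approx: "\<bar>exp (- 2) - 0.1353\<bar> < (0.00005 :: real)"
proof -
  have "2.7182 < exp (1::real)" "exp (1::real) < 2.7183"
    using abs_le_D1[OF e_approx_32] abs_le_D2[OF e_approx_32] by simp_all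
  then have "2.7182 * 2.7182 < exp 1 * exp (1::real)" "exp 1 * exp (1::real) < 2.7183 * 2.7183"
    by (intro mult_strict_mono; simp)+
  \<comment> \<open>The reciprocals of these bounds, about 0.135346 and 0.135318, lie strictly
    between 0.13525 and 0.13535.\<close>
  then have "7.3885 < exp (2::real)" "exp (2::real) < 7.39"
    by (simp_all add: exp_add[symmetric])
  then show ?thesis
    by (simp add: exp_minus abs_less_iff field_simps)
qed

theorem corollary3p2:
  fixes f g g' g'' :: "real \<Rightarrow> real"
  assumes "prob_density f"
    and "\<exists>c>0. \<forall>x>0. f x = c * exp (g x)"
    and "\<forall>x\<le>0. f x = 0"
    and "\<And>x. 0 \<le> x \<Longrightarrow> (g has_real_derivative g' x) (at x within {0..})"
    and "\<And>x. 0 \<le> x \<Longrightarrow> (g' has_real_derivative g'' x) (at x within {0..})"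
    and "bdd_above ((\<lambda>x. \<bar>g' x\<bar>) ` {0..})"
  shows "(\<forall>l>0. (\<lambda>d. \<integral>x. accept_prob f (l / real d) d x \<partial>target_law f d)
             \<longlonglongrightarrow> acc_limit f l)
       \<and> is_arg_max (speed f) (\<lambda>l. 0 < l) (8 / fstar f)
       \<and> acc_limit f (8 / fstar f) = exp (- 2)
       \<and> \<bar>acc_limit f (8 / fstar f) - 0.1353\<bar> < 0.00005"
proof -
  obtain c where c: "0 < c" "\<And>x. 0 < x \<Longrightarrow> f x = c * exp (g x)"
    using assms(2) by blast
  obtain M where M: "\<And>x. 0 \<le> x \<Longrightarrow> \<bar>g' x\<bar> \<le> M"
    using assms(6) by (auto simp: bdd_above_def)
  \<comment> \<open>The second derivative enters through this continuity, the form in which the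
    locale assumes smoothness of \<open>g'\<close>.\<close>
  have "continuous_on {0..} g'"
    using assms(5) by (intro DERIV_continuous_on) auto
  then interpret half_line_density f g g' c M
    using assms(1,3,4) c M by unfold_locales auto
  have "acc_limit f (8 / fstar f) = exp (- 2)"
    using fstar_pos by (simp add: acc_limit_def)
  then show ?thesis
    using expected_acceptance_tendsto speed_is_arg_max[OF fstar_pos] exp_minus_two_approx by simp
qed

end
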